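(* Let $q$ be a prime power, let $C\subseteq\mathbb{F}_q^n$ be an $[n,k]$ code over $\mathbb{F}_q$ with dual code $C^\perp$, let $1\le d\le n$, let $f\in\mathrm{Harm}_d(n)$, and let $r\ge 0$ be an integer. Then, as polynomials in $x,y$, $$Z_{C^{\perp},f}^{(r)}(x,y)=\sum_{j=0}^{r}\sum_{\ell=0}^{j}(-1)^{r+d-j}\,\frac{q^{\binom{r-j}{2}-j(r-j)-\ell(j-\ell)-j(k-d)}}{[r-j]_{q}\,[j-\ell]_{q}}\;Z_{C,f}^{(\ell)}\left(x+(q^{j}-1)y,\;x-y\right).$$
   Context: Let $E=\{1,\dots,n\}$ and let $E_d$ be the set of $d$-element subsets of $E$. $\mathrm{Harm}_d(n)$ is the space of functions $f:E_d\to\mathbb{R}$ such that $\sum_{Z\in E_d,\,Y\subseteq Z}f(Z)=0$ for every $Y\in E_{d-1}$. For $X\subseteq E$ put $\widetilde f(X)=\sum_{Z\in E_d,\,Z\subseteq X}f(Z)$. An $[n,k]$ code over $\mathbb{F}_q$ is a $k$-dimensional linear subspace of $\mathbb{F}_q^n$; its dual $C^\perp$ is its orthogonal complement under the standard inner product $\mathbf{u}\cdot\mathbf{v}=\sum_i u_iv_i$. For a vector $\mathbf u$, $\mathrm{supp}(\mathbf u)=\{i\in E: u_i\ne 0\}$; for a set $D$ of vectors, $\mathrm{Supp}(D)=\bigcup_{\mathbf u\in D}\mathrm{supp}(\mathbf u)$ and $\mathrm{wt}(D)=|\mathrm{Supp}(D)|$. $\mathcal{D}_r(C)$ is the set of $r$-dimensional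 linear subspaces of $C$ (empty if $r>\dim C$), and $$A_{i,f}^{(r)}(C)=\sum_{D\in\mathcal{D}_r(C),\ \mathrm{wt}(D)=i}\widetilde f(\mathrm{Supp}(D)).$$ The harmonic $r$-th higher weight enumerator is $W_{C,f}^{(r)}(x,y)=\sum_{i=0}^n A_{i,f}^{(r)}(C)x^{n-i}y^i$; it equals $(xy)^dZ_{C,f}^{(r)}(x,y)$, where $$Z_{C,f}^{(r)}(x,y)=\sum_{i=d}^{n-d}A_{i,f}^{(r)}(C)\,x^{n-i-d}y^{i-d}$$ (an empty sum is $0$). For integers $a\ge 0$, $[a]_q=\prod_{i=0}^{a-1}(q^a-q^i)$ (so $[0]_q=1$). *)

theory Defs
  imports "HOL-Analysis.Analysis" "HOL-Computational_Algebra.Polynomial"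
begin

(* The coordinate set E = {1,...,n} is a finite index type 'n with n = CARD('n).
   The field F_q is a type 'a of classes field and finite with q = CARD('a), so F_q^n is 'a ^ 'n,
   with the linear algebra of the interpretation vec (scalar multiplication by *s). *)

(* A function on the d-subsets of E is represented by a function on all subsets.  Its values at
   sets of other cardinalities are irrelevant: nothing below refers to them. *)

definition Harm :: "nat \<Rightarrow> ('n::finite set \<Rightarrow> real) set" where
  "Harm d = {f. \<forall>Y. Suc (card Y) = d \<longrightarrow> (\<Sum>Z | card Z = d \<and> Y \<subseteq> Z. f Z) = 0}"

definition harm_ext :: "nat \<Rightarrow> ('n::finite set \<Rightarrow> real) \<Rightarrow> 'n set \<Rightarrow> real" where
  "harm_ext d f X = (\<Sum>Z | card Z = d \<and> Z \<subseteq> X. f Z)"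

definition dual_code :: "('a::{field,finite} ^ 'n::finite) set \<Rightarrow> ('a ^ 'n) set" where
  "dual_code C = {u. \<forall>v\<in>C. (\<Sum>i\<in>UNIV. u $ i * v $ i) = 0}"

definition supp :: "'a::{field,finite} ^ 'n::finite \<Rightarrow> 'n set" where
  "supp u = {i. u $ i \<noteq> 0}"

definition Supp :: "('a::{field,finite} ^ 'n::finite) set \<Rightarrow> 'n set" where
  "Supp D = (\<Union>u\<in>D. supp u)"

definition wt :: "('a::{field,finite} ^ 'n::finite) set \<Rightarrow> nat" where
  "wt D = card (Supp D)"

definition subcodes :: "nat \<Rightarrow> ('a::{field,finite} ^ 'n::finite) set \<Rightarrow> ('a ^ 'n) set set" where
  "subcodes r C = {D. vec.subspace D \<and> D \<subseteq> C \<and> vec.dim D = r}"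

definition A_harm ::
    "nat \<Rightarrow> nat \<Rightarrow> ('n::finite set \<Rightarrow> real) \<Rightarrow> ('a::{field,finite} ^ 'n) set \<Rightarrow> nat \<Rightarrow> real" where
  "A_harm r d f C i = (\<Sum>D | D \<in> subcodes r C \<and> wt D = i. harm_ext d f (Supp D))"

(* The ring R[x,y] is the type real poly poly: polynomials in y whose coefficients are
   polynomials in x. *)

abbreviation (input) const2 :: "real \<Rightarrow> real poly poly" where
  "const2 c \<equiv> [:[:c:]:]"

definition var_x :: "real poly poly" where
  "var_x = [:[:0, 1:]:]"

definition var_y :: "real poly poly" where
  "var_y = [:0, 1:]"

(* Z_harm r d f C u v is Z(u,v) for arbitrary elements u, v of R[x,y]; the polynomial itself is
   the case u = x, v = y.  No subtraction
   truncates for d \<le> CARD('n), since i \<le> CARD('n) - d then gives i + d \<le> CARD('n). *)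

definition Z_harm ::
    "nat \<Rightarrow> nat \<Rightarrow> ('n::finite set \<Rightarrow> real) \<Rightarrow> ('a::{field,finite} ^ 'n) set
      \<Rightarrow> real poly poly \<Rightarrow> real poly poly \<Rightarrow> real poly poly" where
  "Z_harm r d f C u v =
     (\<Sum>i = d..CARD('n) - d. const2 (A_harm r d f C i) * u ^ (CARD('n) - i - d) * v ^ (i - d))"

definition q_bracket :: "nat \<Rightarrow> nat \<Rightarrow> real" where
  "q_bracket q a = (\<Prod>i<a. real q ^ a - real q ^ i)"

end

theory Submission
  imports Defs
begin

text \<open>
  The proof passes from subspaces to tuples of codewords. A \<open>j\<close>-tuple of codewords of \<open>C\<close> is a word
  over an alphabet of size \<open>Q = q ^ j\<close>, and for such words there is an ordinary harmonic MacWilliams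
  identity: duality replaces \<open>(x, y)\<close> by \<open>(x + (Q - 1) y, x - y)\<close> at the cost of a factor
  \<open>(-1) ^ d * Q ^ (d - k)\<close>. The two sums of the theorem are the two changes of basis between
  \<open>r\<close>-dimensional subspaces and \<open>j\<close>-tuples.

  Everything about the code enters through the numbers \<open>z J\<close> of codewords supported in \<open>J\<close>.

  \<^item> The \<open>r\<close>-dimensional subcodes with support inside \<open>J\<close> number
    \<open>(\<Prod>i<r. z J - q ^ i) / q_bracket q r\<close>, by counting ordered bases (\<open>card_subcodes\<close>).
  \<^item> The \<open>j\<close>-tuples with support inside \<open>J\<close> number \<open>z J ^ j\<close>. The products and the powers are two
    bases of the polynomials in \<open>z\<close>; both transition matrices are Gaussian
    (\<open>q_binomial_theorem\<close>, \<open>power_eq_qbinom_sum\<close>).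
  \<^item> For the dual code, \<open>q ^ k * z' J = q ^ card J * z (- J)\<close>, where \<open>z'\<close> is \<open>z\<close> for the dual code
    (\<open>card_shortened_dual\<close>). Counting orthogonal pairs of vectors gives this directly, without additive
    characters.

  Hence the subcodes of the dual code inside \<open>J\<close> are counted by a combination of the terms
  \<open>(q ^ j) ^ card J * z (- J) ^ j\<close>. A relation of this form between the numbers of supports inside \<open>J\<close>
  and inside \<open>- J\<close> determines one family of numbers from the other, and \<open>harm_macwilliams\<close>
  turns it into an identity of the harmonic enumerators. What is specific to harmonic functions in that
  step is \<open>harm_sum_inter\<close>: summing \<open>f Z\<close> against any function of \<open>card (Z \<inter> A)\<close> gives a multiple of
  \<open>harm_ext d f A\<close>.

  Identities of polynomials are checked at real points with nonzero coordinates, where the factor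
  \<open>(x * y) ^ d\<close> can be cancelled.
\<close>

section \<open>Gaussian binomial coefficients\<close>

text \<open>
  Gaussian binomial coefficients; the recursion is the Pascal rule that both expansions below use.
  For a prime power \<open>q\<close> they count the \<open>k\<close>-dimensional subspaces of an \<open>n\<close>-dimensional space.
\<close>

primrec qbinom :: "'a::comm_ring_1 \<Rightarrow> nat \<Rightarrow> nat \<Rightarrow> 'a" where
  "qbinom q 0 k = (if k = 0 then 1 else 0)"
| "qbinom q (Suc n) k = (case k of 0 \<Rightarrow> 1 | Suc k' \<Rightarrow> qbinom q n k' + q ^ k * qbinom q n k)"

lemma qbinom_0_right [simp]: "qbinom q n 0 = 1"
  by (cases n) auto

lemma qbinom_Suc_Suc:
  "qbinom q (Suc n) (Suc k) = qbinom q n k + q ^ Suc k * qbinom q n (Suc k)"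
  by simp

lemma qbinom_eq_0: "n < k \<Longrightarrow> qbinom q n k = 0"
  by (induction n arbitrary: k) (auto split: nat.split)

lemma qbinom_self [simp]: "qbinom q n n = 1"
  by (induction n) (auto simp: qbinom_eq_0)

text \<open>
  Multiplying by the factor \<open>z - q ^ r\<close> acts on the coefficients by the Pascal rule, because
  \<open>Suc m choose 2 = (m choose 2) + m\<close> makes the powers of \<open>q\<close> match.
\<close>

lemma q_binomial_theorem:
  fixes q z :: "'a::comm_ring_1"
  shows "(\<Prod>i<r. z - q ^ i) = (\<Sum>j\<le>r. (-1) ^ (r - j) * q ^ ((r - j) choose 2) * qbinom q r j * z ^ j)"
proof (induction r)
  case 0
  show ?case by (simp add: binomial_eq_0)
next
  case (Suc r)
  let ?c = "\<lambda>r j. (-1) ^ (r - j) * q ^ ((r - j) choose 2) * qbinom q r j :: 'a"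
  have rec: "?c (Suc r) (Suc j) = ?c r j - q ^ r * ?c r (Suc j)" if "j \<le> r" for j
  proof (cases "j = r")
    case True
    then show ?thesis by (simp add: qbinom_eq_0)
  next
    case False
    define m where "m = r - Suc j"
    have r: "r = Suc (j + m)" using False that unfolding m_def by simp
    have ch: "Suc m choose 2 = (m choose 2) + m"
      by (simp add: numeral_2_eq_2)
    have s: "Suc r - Suc j = Suc m" "r - j = Suc m" "r - Suc j = m" using r by auto
    show ?thesis unfolding s qbinom_Suc_Suc ch
      by (simp add: r power_add algebra_simps)
  qed
  have rec0: "?c (Suc r) 0 = - (q ^ r * ?c r 0)"
  proof -
    have ch: "Suc r choose 2 = (r choose 2) + r"
      by (simp add: numeral_2_eq_2)
    show ?thesis by (simp add: ch power_add)
  qed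
  have "(\<Prod>i<Suc r. z - q ^ i) = (\<Sum>j\<le>r. ?c r j * z ^ j) * (z - q ^ r)"
    using Suc.IH by simp
  also have "\<dots> = (\<Sum>j\<le>r. ?c r j * z ^ Suc j) - q ^ r * (\<Sum>j\<le>r. ?c r j * z ^ j)"
    unfolding right_diff_distrib sum_distrib_right by (simp add: sum_distrib_left mult_ac)
  also have "(\<Sum>j\<le>r. ?c r j * z ^ j) = (\<Sum>j\<le>Suc r. ?c r j * z ^ j)"
    by (simp add: qbinom_eq_0)
  also have "\<dots> = ?c r 0 + (\<Sum>j\<le>r. ?c r (Suc j) * z ^ Suc j)"
    by (subst sum.atMost_Suc_shift) simp
  also have "(\<Sum>j\<le>r. ?c r j * z ^ Suc j)
       - q ^ r * (?c r 0 + (\<Sum>j\<le>r. ?c r (Suc j) * z ^ Suc j))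
      = ?c (Suc r) 0 + (\<Sum>j\<le>r. (?c r j - q ^ r * ?c r (Suc j)) * z ^ Suc j)"
    unfolding rec0 by (simp add: left_diff_distrib sum_subtractf sum_distrib_left algebra_simps)
  also have "(\<Sum>j\<le>r. (?c r j - q ^ r * ?c r (Suc j)) * z ^ Suc j)
       = (\<Sum>j\<le>r. ?c (Suc r) (Suc j) * z ^ Suc j)"
    by (intro sum.cong refl) (simp only: rec atMost_iff)
  also have "?c (Suc r) 0 + \<dots> = (\<Sum>j\<le>Suc r. ?c (Suc r) j * z ^ j)"
    by (subst sum.atMost_Suc_shift) simp
  finally show ?case .
qed

text \<open>
  The inverse of the previous expansion. Since \<open>z = (z - q ^ l) + q ^ l\<close>, multiplication by \<open>z\<close> acts on the
  products exactly as the Pascal rule acts on the coefficients.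
\<close>

lemma power_eq_qbinom_sum:
  fixes q z :: "'a::comm_ring_1"
  shows "z ^ j = (\<Sum>l\<le>j. qbinom q j l * (\<Prod>i<l. z - q ^ i))"
proof (induction j)
  case 0
  show ?case by simp
next
  case (Suc j)
  let ?P = "\<lambda>l. \<Prod>i<l. z - q ^ i"
  have "z ^ Suc j = (\<Sum>l\<le>j. qbinom q j l * (z * ?P l))"
    by (simp add: Suc.IH sum_distrib_left mult_ac)
  also have "\<dots> = (\<Sum>l\<le>j. qbinom q j l * ?P (Suc l)) + (\<Sum>l\<le>j. q ^ l * qbinom q j l * ?P l)"
    by (simp add: algebra_simps flip: sum.distrib)
  also have "(\<Sum>l\<le>j. q ^ l * qbinom q j l * ?P l) = (\<Sum>l\<le>Suc j. q ^ l * qbinom q j l * ?P l)"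
    by (simp add: qbinom_eq_0)
  also have "\<dots> = 1 + (\<Sum>l\<le>j. q ^ Suc l * qbinom q j (Suc l) * ?P (Suc l))"
    by (subst sum.atMost_Suc_shift) simp
  also have "(\<Sum>l\<le>j. qbinom q j l * ?P (Suc l)) + \<dots>
      = 1 + (\<Sum>l\<le>j. qbinom q (Suc j) (Suc l) * ?P (Suc l))"
    unfolding qbinom_Suc_Suc by (simp add: distrib_right sum.distrib del: prod.lessThan_Suc)
  also have "\<dots> = (\<Sum>l\<le>Suc j. qbinom q (Suc j) l * ?P l)"
    by (subst sum.atMost_Suc_shift) (simp del: prod.lessThan_Suc)
  finally show ?case .
qed

lemma q_bracket_Suc: "q_bracket q (Suc a) = (real q ^ Suc a - 1) * real q ^ a * q_bracket q a"
proof -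
  have "q_bracket q (Suc a) = (real q ^ Suc a - 1) * (\<Prod>i<a. real q * (real q ^ a - real q ^ i))"
    unfolding q_bracket_def by (subst prod.lessThan_Suc_shift) (simp add: algebra_simps)
  then show ?thesis by (simp add: prod.distrib q_bracket_def)
qed

lemma q_bracket_pos: "2 \<le> q \<Longrightarrow> q_bracket q a > 0"
  unfolding q_bracket_def by (intro prod_pos) (auto intro: power_strict_increasing)

text \<open>
  The quotient formula for Gaussian binomials, with \<open>q_bracket q a\<close> (the order of the general linear group)
  in the role of the factorial. The extra power \<open>q ^ (a * b)\<close> accounts for the off-diagonal blocks of the
  invertible block triangular matrices, which are the stabilizer of an \<open>a\<close>-dimensional subspace.
\<close>

lemma qbinom_q_bracket:
  "qbinom (real q) (a + b) a * q_bracket q a * q_bracket q b * real q ^ (a * b) = q_bracket q (a + b)"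
proof (induction "a + b" arbitrary: a b)
  case 0
  then show ?case by (simp add: q_bracket_def)
next
  case (Suc m)
  show ?case
  proof (cases "a = 0 \<or> b = 0")
    case True
    then show ?thesis by (auto simp: q_bracket_def)
  next
    case False
    then obtain a' b' where ab: "a = Suc a'" "b = Suc b'" by (meson not0_implies_Suc)
    let ?q = "real q"
    have m1: "m = a' + b" and m2: "m = a + b'" using Suc.hyps(2) ab by auto
    note IH1 = Suc.hyps(1)[OF m1, folded m1]
    note IH2 = Suc.hyps(1)[OF m2, folded m2]
    have pascal: "qbinom ?q (a + b) a = qbinom ?q m a' + ?q ^ a * qbinom ?q m a"
      using qbinom_Suc_Suc[of ?q m a'] unfolding Suc.hyps(2) ab(1)[symmetric] .
    have a: "q_bracket q a = (?q ^ a - 1) * ?q ^ a' * q_bracket q a'"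
      and b: "q_bracket q b = (?q ^ b - 1) * ?q ^ b' * q_bracket q b'"
      unfolding ab by (rule q_bracket_Suc)+
    have pa: "?q ^ (a * b) = ?q ^ b * ?q ^ (a' * b)"
      and pb: "?q ^ (a * b) = ?q ^ a * ?q ^ (a * b')"
      unfolding ab by (simp_all add: power_add)
    have "qbinom ?q (a + b) a * q_bracket q a * q_bracket q b * ?q ^ (a * b)
       = qbinom ?q m a' * q_bracket q a * q_bracket q b * ?q ^ (a * b)
       + ?q ^ a * (qbinom ?q m a * q_bracket q a * q_bracket q b * ?q ^ (a * b))"
      unfolding pascal by (simp add: distrib_right)
    also have "qbinom ?q m a' * q_bracket q a * q_bracket q b * ?q ^ (a * b)
       = (?q ^ a - 1) * ?q ^ (a' + b) * (qbinom ?q m a' * q_bracket q a' * q_bracket q b * ?q ^ (a' * b))"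
      unfolding a pa by (simp add: power_add)
    also have "qbinom ?q m a * q_bracket q a * q_bracket q b * ?q ^ (a * b)
       = (?q ^ b - 1) * ?q ^ (a + b') * (qbinom ?q m a * q_bracket q a * q_bracket q b' * ?q ^ (a * b'))"
      unfolding b pb by (simp add: power_add)
    also have "(?q ^ a - 1) * ?q ^ (a' + b) * (qbinom ?q m a' * q_bracket q a' * q_bracket q b * ?q ^ (a' * b))
       + ?q ^ a * ((?q ^ b - 1) * ?q ^ (a + b') * (qbinom ?q m a * q_bracket q a * q_bracket q b' * ?q ^ (a * b')))
       = (?q ^ a - 1) * ?q ^ m * q_bracket q m + ?q ^ a * ((?q ^ b - 1) * ?q ^ m * q_bracket q m)"
      unfolding IH1 IH2 m1[symmetric] m2[symmetric] ..
    also have "\<dots> = (?q ^ Suc m - 1) * ?q ^ m * q_bracket q m"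
      unfolding Suc.hyps(2) by (simp add: power_add algebra_simps)
    also have "\<dots> = q_bracket q (a + b)"
      using q_bracket_Suc[of q m] unfolding Suc.hyps(2) by simp
    finally show ?thesis .
  qed
qed

section \<open>Sums of a harmonic function over levels of the Boolean lattice\<close>

text \<open>
  Sum the defining condition of a harmonic function over all sets \<open>Y\<close> of size \<open>d - 1\<close> that meet \<open>A\<close> in
  \<open>s\<close> points. A set \<open>Z\<close> arises from such a \<open>Y\<close> either by adding a point outside \<open>A\<close>, in \<open>d - s\<close>
  ways if it meets \<open>A\<close> in \<open>s\<close> points, or by adding a point of \<open>A\<close>, in \<open>s + 1\<close> ways if it meets \<open>A\<close> in
  \<open>s + 1\<close> points.
\<close>

lemma harm_level_recurrence:
  fixes f :: "'n::finite set \<Rightarrow> real"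
  assumes f: "f \<in> Harm d" and s: "s < d"
  shows "real (d - s) * (\<Sum>Z | card Z = d \<and> card (Z \<inter> A) = s. f Z)
       + real (Suc s) * (\<Sum>Z | card Z = d \<and> card (Z \<inter> A) = Suc s. f Z) = 0"
proof -
  let ?Ys = "{Y::'n set. Suc (card Y) = d \<and> card (Y \<inter> A) = s}"
  let ?Zs = "{Z::'n set. card Z = d}"
  have count: "card {Y \<in> ?Ys. Y \<subseteq> Z} =
      (if card (Z \<inter> A) = s then d - s else if card (Z \<inter> A) = Suc s then Suc s else 0)"
    if Z: "card Z = d" for Z
  proof -
    have eq: "{Y \<in> ?Ys. Y \<subseteq> Z} = (\<lambda>z. Z - {z}) ` {z \<in> Z. card ((Z - {z}) \<inter> A) = s}"
    proof (intro equalityI subsetI)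
      fix Y assume "Y \<in> {Y \<in> ?Ys. Y \<subseteq> Z}"
      then have Y: "Y \<subseteq> Z" "Suc (card Y) = card Z" "card (Y \<inter> A) = s" using Z by auto
      then have "card (Z - Y) = 1" by (simp add: card_Diff_subset)
      then obtain z where z: "Z - Y = {z}" by (auto simp: card_1_singleton_iff)
      then have "Y = Z - {z}" "z \<in> Z" using Y by auto
      then show "Y \<in> (\<lambda>z. Z - {z}) ` {z \<in> Z. card ((Z - {z}) \<inter> A) = s}" using Y by auto
    next
      fix Y assume "Y \<in> (\<lambda>z. Z - {z}) ` {z \<in> Z. card ((Z - {z}) \<inter> A) = s}"
      then obtain z where "z \<in> Z" "card ((Z - {z}) \<inter> A) = s" "Y = Z - {z}" by auto
      moreover from \<open>z \<in> Z\<close> have "Suc (card (Z - {z})) = d"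
        using Z card_Suc_Diff1[of Z z] by simp
      ultimately show "Y \<in> {Y \<in> ?Ys. Y \<subseteq> Z}" by auto
    qed
    have inj: "inj_on (\<lambda>z. Z - {z}) {z \<in> Z. card ((Z - {z}) \<inter> A) = s}"
      by (auto simp: inj_on_def)
    have c: "card ((Z - {z}) \<inter> A) = (if z \<in> A then card (Z \<inter> A) - 1 else card (Z \<inter> A))"
      if "z \<in> Z" for z
    proof -
      have "(Z - {z}) \<inter> A = (Z \<inter> A) - {z}" by auto
      then show ?thesis using that by simp
    qed
    have pos: "card (Z \<inter> A) > 0" if "z \<in> Z" "z \<in> A" for z
      using that by (auto simp: card_gt_0_iff)
    have split: "card Z = card (Z \<inter> A) + card (Z - A)"
      by (metis card_Diff_subset_Int card_mono finite finite_Int inf_le1 le_add_diff_inverse)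
    have "{z \<in> Z. card ((Z - {z}) \<inter> A) = s} =
        (if card (Z \<inter> A) = s then Z - A else if card (Z \<inter> A) = Suc s then Z \<inter> A else {})"
    proof -
      have "card (Z \<inter> A) = Suc s \<or> card (Z \<inter> A) = s" "card (Z \<inter> A) = Suc s \<longleftrightarrow> z \<in> A"
        if "z \<in> Z" "card ((Z - {z}) \<inter> A) = s" for z
        using c[OF that(1)] that pos[OF that(1)] by (auto split: if_splits)
      moreover have "card ((Z - {z}) \<inter> A) = s"
        if "z \<in> Z" "card (Z \<inter> A) = s \<and> z \<notin> A \<or> card (Z \<inter> A) = Suc s \<and> z \<in> A" for z
        using c[OF that(1)] that by auto
      ultimately show ?thesis by auto
    qed
    then show ?thesis
      unfolding eq card_image[OF inj] using split Z by auto
  qed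
  have "0 = (\<Sum>Y\<in>?Ys. \<Sum>Z | card Z = d \<and> Y \<subseteq> Z. f Z)"
    using f by (intro sum.neutral[symmetric]) (auto simp: Harm_def)
  also have "\<dots> = (\<Sum>Y\<in>?Ys. \<Sum>Z\<in>?Zs. if Y \<subseteq> Z then f Z else 0)"
    by (rule sum.cong[OF refl]) (simp add: sum.inter_filter[symmetric])
  also have "\<dots> = (\<Sum>Z\<in>?Zs. \<Sum>Y\<in>?Ys. if Y \<subseteq> Z then f Z else 0)"
    by (rule sum.swap)
  also have "\<dots> = (\<Sum>Z\<in>?Zs. real (card {Y \<in> ?Ys. Y \<subseteq> Z}) * f Z)"
    by (rule sum.cong[OF refl]) (simp add: sum.inter_filter[symmetric])
  also have "\<dots> = (\<Sum>Z\<in>?Zs. (if card (Z \<inter> A) = s then real (d - s) * f Z else 0)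
                   + (if card (Z \<inter> A) = Suc s then real (Suc s) * f Z else 0))"
  proof (rule sum.cong[OF refl])
    fix Z assume "Z \<in> ?Zs"
    then have c: "card {Y \<in> ?Ys. Y \<subseteq> Z} =
      (if card (Z \<inter> A) = s then d - s else if card (Z \<inter> A) = Suc s then Suc s else 0)"
      by (intro count) simp
    show "real (card {Y \<in> ?Ys. Y \<subseteq> Z}) * f Z =
        (if card (Z \<inter> A) = s then real (d - s) * f Z else 0)
        + (if card (Z \<inter> A) = Suc s then real (Suc s) * f Z else 0)"
      unfolding c by simp
  qed
  also have "\<dots> = real (d - s) * (\<Sum>Z | card Z = d \<and> card (Z \<inter> A) = s. f Z)
       + real (Suc s) * (\<Sum>Z | card Z = d \<and> card (Z \<inter> A) = Suc s. f Z)"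
    by (simp add: sum.distrib sum.inter_filter[symmetric] sum_distrib_left)
  finally show ?thesis by simp
qed

text \<open>
  Downward induction along the recurrence, starting from \<open>s = d\<close>, where the sum is \<open>harm_ext d f A\<close>.
\<close>

lemma harm_level_sum:
  fixes f :: "'n::finite set \<Rightarrow> real"
  assumes f: "f \<in> Harm d" and "s \<le> d"
  shows "(\<Sum>Z | card Z = d \<and> card (Z \<inter> A) = s. f Z)
       = (-1) ^ (d - s) * real (d choose s) * harm_ext d f A"
  using \<open>s \<le> d\<close>
proof (induction s rule: inc_induct)
  case base
  have "card (Z \<inter> A) = card Z \<longleftrightarrow> Z \<subseteq> A" for Z
    by (metis card_subset_eq finite inf.absorb_iff1 inf_le1)
  then have "{Z. card Z = d \<and> card (Z \<inter> A) = d} = {Z. card Z = d \<and> Z \<subseteq> A}" by auto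
  then show ?case by (simp add: harm_ext_def)
next
  case (step s)
  let ?S = "\<lambda>s. \<Sum>Z | card Z = d \<and> card (Z \<inter> A) = s. f Z"
  have sgn: "(-1::real) ^ (d - s) = - ((-1) ^ (d - Suc s))"
    using step.hyps by (simp flip: Suc_diff_Suc)
  have ch: "real (Suc s) * real (d choose Suc s) = real (d - s) * real (d choose s)"
    by (metis binomial_absorb_comp binomial_absorption of_nat_mult)
  have "real (d - s) * ?S s = - (real (Suc s) * ?S (Suc s))"
    using harm_level_recurrence[OF f, of s A] step.hyps by linarith
  also have "\<dots> = - ((-1) ^ (d - Suc s)) * (real (Suc s) * real (d choose Suc s)) * harm_ext d f A"
    unfolding step.IH by simp
  also have "\<dots> = real (d - s) * ((-1) ^ (d - s) * real (d choose s) * harm_ext d f A)"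
    unfolding ch sgn by simp
  finally show ?case using step.hyps by simp
qed

lemma harm_sum_inter:
  fixes f :: "'n::finite set \<Rightarrow> real"
  assumes f: "f \<in> Harm d"
  shows "(\<Sum>Z | card Z = d. f Z * g (card (Z \<inter> A)))
       = harm_ext d f A * (\<Sum>s\<le>d. (-1) ^ (d - s) * real (d choose s) * g s)"
proof -
  have le: "card (Z \<inter> A) \<le> d" if "card Z = d" for Z :: "'n set"
    using that card_mono[of Z "Z \<inter> A"] by auto
  have "(\<Sum>Z | card Z = d. f Z * g (card (Z \<inter> A)))
      = (\<Sum>s\<le>d. \<Sum>Z \<in> {Z \<in> {Z. card Z = d}. card (Z \<inter> A) = s}. f Z * g (card (Z \<inter> A)))"
    by (rule sum.group[symmetric]) (use le in auto)
  also have "\<dots> = (\<Sum>s\<le>d. (\<Sum>Z | card Z = d \<and> card (Z \<inter> A) = s. f Z) * g s)"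
    by (auto simp: sum_distrib_right intro!: sum.cong)
  also have "\<dots> = harm_ext d f A * (\<Sum>s\<le>d. (-1) ^ (d - s) * real (d choose s) * g s)"
    using harm_level_sum[OF f] by (simp add: sum_distrib_left mult_ac)
  finally show ?thesis .
qed

text \<open>
  If \<open>X\<close> is large, its complement has fewer than \<open>d\<close> points, so the level sum for \<open>s = 0\<close> is empty; but
  that sum is \<open>harm_ext d f X\<close> up to sign.
\<close>

lemma harm_ext_outside:
  fixes f :: "'n::finite set \<Rightarrow> real"
  assumes f: "f \<in> Harm d" and "card X < d \<or> card X > CARD('n) - d"
  shows "harm_ext d f X = 0"
proof (cases "card X < d")
  case True
  then have e: "{Z. card Z = d \<and> Z \<subseteq> X} = {}"
    using card_mono[OF finite[of X]] by (auto simp: not_le[symmetric])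
  show ?thesis unfolding harm_ext_def e by simp
next
  case False
  have "{Z. card Z = d \<and> card (Z \<inter> X) = 0} = {}"
  proof -
    have "card Z + card X \<le> CARD('n)" if "Z \<inter> X = {}" for Z
      using that card_mono[of UNIV "Z \<union> X"] by (simp add: card_Un_disjoint)
    moreover have "CARD('n) < d + card X" using False assms(2) by linarith
    ultimately have "card Z \<noteq> d" if "Z \<inter> X = {}" for Z
      using that by (metis leD)
    then show ?thesis by auto
  qed
  then have "(\<Sum>Z | card Z = d \<and> card (Z \<inter> X) = 0. f Z) = 0"
    by (metis sum.empty)
  then show ?thesis using harm_level_sum[OF f, of 0 X] by simp
qed

section \<open>A harmonic MacWilliams identity for set functions\<close>

text \<open>
  The enumerator of a weight \<open>a\<close> on supports, evaluated at real numbers. The exponents truncate only for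
  sets \<open>X\<close> with fewer than \<open>d\<close> or more than \<open>n - d\<close> points, where \<open>harm_ext d f X = 0\<close> for harmonic \<open>f\<close>.
\<close>

definition harm_poly ::
    "nat \<Rightarrow> ('n::finite set \<Rightarrow> real) \<Rightarrow> ('n set \<Rightarrow> real) \<Rightarrow> real \<Rightarrow> real \<Rightarrow> real" where
  "harm_poly d f a u v =
     (\<Sum>X\<in>UNIV. a X * harm_ext d f X * u ^ (CARD('n) - card X - d) * v ^ (card X - d))"

text \<open>
  For an alphabet of size \<open>Q\<close>, a nontrivial additive character and a fixed word with support \<open>A\<close>, this is the
  character sum over all words with support exactly \<open>X\<close>.
\<close>

definition mw_kernel :: "real \<Rightarrow> 'n::finite set \<Rightarrow> 'n set \<Rightarrow> real" where
  "mw_kernel Q A X = (\<Prod>i\<in>X. if i \<in> A then -1 else Q - 1)"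

text \<open>
  The product over \<open>J\<close> of one plus the local factor of the kernel: this factor is \<open>0\<close> on \<open>A\<close> and \<open>Q\<close> off \<open>A\<close>.
\<close>

lemma mw_kernel_sum_subsets:
  "(\<Sum>X\<in>Pow J. mw_kernel Q A X) = (if A \<subseteq> - J then Q ^ card J else 0)"
proof -
  have "(\<Sum>X\<in>Pow J. mw_kernel Q A X) = (\<Prod>i\<in>J. (if i \<in> A then -1 else Q - 1) + 1)"
    unfolding mw_kernel_def by (subst prod_add) auto
  also have "\<dots> = (if A \<subseteq> - J then Q ^ card J else 0)"
  proof (cases "A \<subseteq> - J")
    case True
    then have "(\<Prod>i\<in>J. (if i \<in> A then -1 else Q - 1) + 1) = (\<Prod>i\<in>J. Q)"
      by (intro prod.cong refl) auto
    then show ?thesis using True by simp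
  next
    case False
    then obtain i where "i \<in> A" "i \<in> J" by auto
    then show ?thesis using False by (auto intro!: prod_zero)
  qed
  finally show ?thesis .
qed

lemma sum_subsets_eqD:
  fixes b b' :: "'n::finite set \<Rightarrow> real"
  assumes "\<And>J. (\<Sum>X\<in>Pow J. b X) = (\<Sum>X\<in>Pow J. b' X)"
  shows "b = b'"
proof
  fix X :: "'n set"
  have "finite X" by simp
  then show "b X = b' X"
  proof (induction X rule: finite_psubset_induct)
    case (psubset X)
    have split: "(\<Sum>Y\<in>Pow X. g Y) = g X + (\<Sum>Y\<in>Pow X - {X}. g Y)" for g :: "'n set \<Rightarrow> real"
      by (rule sum.remove) auto
    have "(\<Sum>Y\<in>Pow X - {X}. b Y) = (\<Sum>Y\<in>Pow X - {X}. b' Y)"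
      by (rule sum.cong[OF refl]) (auto intro!: psubset.IH)
    then show ?case using assms[of X] by (simp add: split)
  qed
qed

text \<open>
  Expanding the product on the right chooses the summand \<open>p i\<close> for \<open>i\<close> in \<open>X\<close>; replacing \<open>x\<close> by \<open>0\<close>
  on \<open>Z\<close> forces \<open>X\<close> to contain \<open>Z\<close>.
\<close>

lemma sum_supersets_prod:
  fixes p :: "'n::finite \<Rightarrow> real"
  shows "(\<Sum>X | Z \<subseteq> X. (\<Prod>i\<in>X. p i) * x ^ card (- X))
       = (\<Prod>i\<in>UNIV. p i + (if i \<in> Z then 0 else x))"
proof -
  have "(\<Prod>i\<in>UNIV. p i + (if i \<in> Z then 0 else x))
      = (\<Sum>X\<in>UNIV. (\<Prod>i\<in>X. p i) * (\<Prod>i\<in>UNIV - X. if i \<in> Z then 0 else x))"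
    by (subst prod_add) auto
  also have "\<dots> = (\<Sum>X\<in>UNIV. if Z \<subseteq> X then (\<Prod>i\<in>X. p i) * x ^ card (- X) else 0)"
  proof (rule sum.cong[OF refl])
    fix X :: "'n set"
    show "(\<Prod>i\<in>X. p i) * (\<Prod>i\<in>UNIV - X. if i \<in> Z then 0 else x)
        = (if Z \<subseteq> X then (\<Prod>i\<in>X. p i) * x ^ card (- X) else 0)"
    proof (cases "Z \<subseteq> X")
      case True
      then have "(\<Prod>i\<in>UNIV - X. if i \<in> Z then 0 else x) = (\<Prod>i\<in>- X. x)"
        by (intro prod.cong) auto
      then show ?thesis using True by simp
    next
      case False
      then obtain i where "i \<in> Z" "i \<notin> X" by auto
      then have "(\<Prod>i\<in>UNIV - X. if i \<in> Z then 0 else x) = 0" by (auto intro!: prod_zero)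
      then show ?thesis using False by simp
    qed
  qed
  also have "\<dots> = (\<Sum>X | Z \<subseteq> X. (\<Prod>i\<in>X. p i) * x ^ card (- X))"
    using sum.inter_filter[of "UNIV :: 'n set set" "\<lambda>X. (\<Prod>i\<in>X. p i) * x ^ card (- X)" "\<lambda>X. Z \<subseteq> X"]
    by simp
  finally show ?thesis ..
qed

lemma prod_two_valued:
  fixes A Z :: "'n::finite set" and Q x y :: real
  assumes Z: "card Z = d"
  shows "(\<Prod>i\<in>UNIV. (if i \<in> A then -1 else Q - 1) * y + (if i \<in> Z then 0 else x))
   = (- y) ^ card (Z \<inter> A) * ((Q - 1) * y) ^ (d - card (Z \<inter> A))
     * (x - y) ^ (card A - card (Z \<inter> A))
     * (x + (Q - 1) * y) ^ (CARD('n) - card A - (d - card (Z \<inter> A)))"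
proof -
  let ?g = "\<lambda>i. (if i \<in> A then -1 else Q - 1) * y + (if i \<in> Z then 0 else x)"
  have c1: "card (Z - A) = d - card (Z \<inter> A)" and c2: "card (A - Z) = card A - card (Z \<inter> A)"
    using Z by (simp_all add: card_Diff_subset_Int Int_commute)
  have c3: "card (- A - Z) = CARD('n) - card A - (d - card (Z \<inter> A))"
  proof -
    have "- A \<inter> Z = Z - A" by auto
    then show ?thesis by (simp add: card_Diff_subset_Int Compl_eq_Diff_UNIV card_Diff_subset c1)
  qed
  have U: "UNIV = ((Z \<inter> A) \<union> (Z - A)) \<union> ((A - Z) \<union> (- A - Z))" by auto
  have "(\<Prod>i\<in>UNIV. ?g i)
      = ((\<Prod>i\<in>Z \<inter> A. ?g i) * (\<Prod>i\<in>Z - A. ?g i)) * ((\<Prod>i\<in>A - Z. ?g i) * (\<Prod>i\<in>- A - Z. ?g i))"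
    by (subst U, subst prod.union_disjoint, simp, simp, blast,
        (subst prod.union_disjoint, simp, simp, blast)+) (rule refl)
  also have "(\<Prod>i\<in>Z \<inter> A. ?g i) = (\<Prod>i\<in>Z \<inter> A. - y)" by (rule prod.cong) auto
  also have "(\<Prod>i\<in>Z - A. ?g i) = (\<Prod>i\<in>Z - A. (Q - 1) * y)" by (rule prod.cong) auto
  also have "(\<Prod>i\<in>A - Z. ?g i) = (\<Prod>i\<in>A - Z. x - y)" by (rule prod.cong) auto
  also have "(\<Prod>i\<in>- A - Z. ?g i) = (\<Prod>i\<in>- A - Z. x + (Q - 1) * y)" by (rule prod.cong) auto
  finally show ?thesis by (simp add: c1 c2 c3)
qed

text \<open>
  The transform of a single support \<open>A\<close>. Interchanging the sums over \<open>X\<close> and over the sets \<open>Z\<close> inside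
  \<open>X\<close>, the inner sum over \<open>X\<close> factors over the coordinates and depends only on \<open>card (Z \<inter> A)\<close>. The level
  sums of \<open>f\<close> then leave a binomial expansion of the \<open>d\<close>-th power of
  \<open>- y * (x + (Q - 1) * y) - (Q - 1) * y * (x - y) = - Q * (x * y)\<close>.
\<close>

lemma harm_poly_kernel:
  fixes f :: "'n::finite set \<Rightarrow> real"
  assumes f: "f \<in> Harm d" and xy: "x \<noteq> 0" "y \<noteq> 0"
  shows "harm_poly d f (mw_kernel Q A) x y
       = (- Q) ^ d * (harm_ext d f A * (x + (Q - 1) * y) ^ (CARD('n) - card A - d)
           * (x - y) ^ (card A - d))"
proof -
  let ?n = "CARD('n)"
  let ?w = "\<lambda>i. (if i \<in> A then -1 else Q - 1)"
  let ?g = "\<lambda>s. (- y) ^ s * ((Q - 1) * y) ^ (d - s) * (x - y) ^ (card A - s)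
     * (x + (Q - 1) * y) ^ (?n - card A - (d - s))"
  \<comment> \<open>Multiplication by \<open>(x * y) ^ d\<close> removes the shifts by \<open>d\<close> in the exponents.\<close>
  have term_X: "mw_kernel Q A X * harm_ext d f X * x ^ (?n - card X - d) * y ^ (card X - d) * (x * y) ^ d
      = (\<Sum>Z | card Z = d. if Z \<subseteq> X then f Z * ((\<Prod>i\<in>X. ?w i * y) * x ^ card (- X)) else 0)"
    (is "?l = ?r") for X
  proof (cases "card X < d \<or> card X > ?n - d")
    case False
    then have d: "?n - card X = (?n - card X - d) + d" "card X = (card X - d) + d" by linarith+
    have p: "x ^ card (- X) = x ^ (?n - card X - d) * x ^ d" "y ^ card X = y ^ (card X - d) * y ^ d"
      using d by (simp_all add: Compl_eq_Diff_UNIV card_Diff_subset flip: power_add)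
    have "?r = (\<Sum>Z | card Z = d \<and> Z \<subseteq> X. f Z) * ((\<Prod>i\<in>X. ?w i * y) * x ^ card (- X))"
      by (simp add: sum.inter_filter[symmetric] sum_distrib_right)
    then show ?thesis
      unfolding harm_ext_def[symmetric] prod.distrib mw_kernel_def
      by (simp add: p power_mult_distrib)
  next
    case True
    have "?r = (\<Sum>Z | card Z = d \<and> Z \<subseteq> X. f Z) * ((\<Prod>i\<in>X. ?w i * y) * x ^ card (- X))"
      by (simp add: sum.inter_filter[symmetric] sum_distrib_right)
    then show ?thesis
      unfolding harm_ext_def[symmetric] using harm_ext_outside[OF f True] by simp
  qed
  have "harm_poly d f (mw_kernel Q A) x y * (x * y) ^ d
      = (\<Sum>X\<in>UNIV. \<Sum>Z | card Z = d. if Z \<subseteq> X then f Z * ((\<Prod>i\<in>X. ?w i * y) * x ^ card (- X)) else 0)"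
    unfolding harm_poly_def sum_distrib_right by (rule sum.cong[OF refl]) (rule term_X)
  also have "\<dots> = (\<Sum>Z | card Z = d. \<Sum>X\<in>UNIV. if Z \<subseteq> X then f Z * ((\<Prod>i\<in>X. ?w i * y) * x ^ card (- X)) else 0)"
    by (rule sum.swap)
  also have "\<dots> = (\<Sum>Z | card Z = d. f Z * ?g (card (Z \<inter> A)))"
  proof (rule sum.cong[OF refl])
    fix Z :: "'n set" assume Z: "Z \<in> {Z. card Z = d}"
    have "(\<Sum>X\<in>UNIV. if Z \<subseteq> X then f Z * ((\<Prod>i\<in>X. ?w i * y) * x ^ card (- X)) else 0)
        = f Z * (\<Sum>X | Z \<subseteq> X. (\<Prod>i\<in>X. ?w i * y) * x ^ card (- X))"
      using sum.inter_filter[of "UNIV :: 'n set set" 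
          "\<lambda>X. f Z * ((\<Prod>i\<in>X. ?w i * y) * x ^ card (- X))" "\<lambda>X. Z \<subseteq> X"]
      by (simp add: sum_distrib_left)
    also have "\<dots> = f Z * ?g (card (Z \<inter> A))"
      using Z by (simp add: sum_supersets_prod prod_two_valued)
    finally show "(\<Sum>X\<in>UNIV. if Z \<subseteq> X then f Z * ((\<Prod>i\<in>X. ?w i * y) * x ^ card (- X)) else 0)
        = f Z * ?g (card (Z \<inter> A))" .
  qed
  also have "\<dots> = harm_ext d f A * (\<Sum>s\<le>d. (-1) ^ (d - s) * real (d choose s) * ?g s)"
    by (rule harm_sum_inter[OF f])
  also have "\<dots> = (- Q) ^ d * (harm_ext d f A * (x + (Q - 1) * y) ^ (?n - card A - d)
           * (x - y) ^ (card A - d)) * (x * y) ^ d"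
  proof (cases "card A < d \<or> card A > ?n - d")
    case True
    then show ?thesis using harm_ext_outside[OF f True] by simp
  next
    case False
    let ?u = "x + (Q - 1) * y" and ?v = "x - y"
    have "(-1) ^ (d - s) * real (d choose s) * ?g s
        = real (d choose s) * (- y * ?u) ^ s * (- ((Q - 1) * y * ?v)) ^ (d - s)
          * (?u ^ (?n - card A - d) * ?v ^ (card A - d))" if "s \<le> d" for s
    proof -
      have e: "?n - card A - (d - s) = s + (?n - card A - d)" "card A - s = (d - s) + (card A - d)"
        using False that by linarith+
      have m: "(- ((Q - 1) * y * ?v)) ^ (d - s) = (-1) ^ (d - s) * ((Q - 1) * y) ^ (d - s) * ?v ^ (d - s)"
        by (metis (no_types) mult_minus1 power_mult_distrib mult_minus_left)
      show ?thesis unfolding e power_add m power_mult_distrib[of "- y" ?u] by (simp only: mult_ac)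
    qed
    then have "(\<Sum>s\<le>d. (-1) ^ (d - s) * real (d choose s) * ?g s)
        = (\<Sum>s\<le>d. real (d choose s) * (- y * ?u) ^ s * (- ((Q - 1) * y * ?v)) ^ (d - s)
          * (?u ^ (?n - card A - d) * ?v ^ (card A - d)))"
      by (intro sum.cong refl) simp
    also have "\<dots> = (- y * ?u + - ((Q - 1) * y * ?v)) ^ d
          * (?u ^ (?n - card A - d) * ?v ^ (card A - d))"
      by (simp only: binomial_ring sum_distrib_right)
    also have "- y * ?u + - ((Q - 1) * y * ?v) = (- Q) * (x * y)" by (simp add: algebra_simps)
    finally show ?thesis by (simp only: power_mult_distrib mult_ac)
  qed
  finally show ?thesis using xy by simp
qed

lemma harm_poly_sum:
  "harm_poly d f (\<lambda>X. \<Sum>j\<in>I. a j X) x y = (\<Sum>j\<in>I. harm_poly d f (a j) x y)"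
  unfolding harm_poly_def by (subst sum.swap) (simp add: sum_distrib_right)

lemma harm_poly_scale: "harm_poly d f (\<lambda>X. c * a X) x y = c * harm_poly d f a x y"
  unfolding harm_poly_def by (simp add: sum_distrib_left mult_ac)

text \<open>
  The sums over all \<open>Pow J\<close> determine \<open>b\<close>, and \<open>mw_kernel_sum_subsets\<close> shows that the superposition of
  kernels has the required sums. By linearity it is enough to transform each kernel.
\<close>

lemma harm_macwilliams:
  fixes f :: "'n::finite set \<Rightarrow> real" and a :: "'j \<Rightarrow> 'n set \<Rightarrow> real"
  assumes f: "f \<in> Harm d" and xy: "x \<noteq> 0" "y \<noteq> 0"
    and dual: "\<And>J. (\<Sum>X\<in>Pow J. b X) = (\<Sum>j\<in>I. K j * Q j ^ card J * (\<Sum>X\<in>Pow (- J). a j X))"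
  shows "harm_poly d f b x y
       = (\<Sum>j\<in>I. K j * (- Q j) ^ d * harm_poly d f (a j) (x + (Q j - 1) * y) (x - y))"
proof -
  have b: "b = (\<lambda>X. \<Sum>j\<in>I. K j * (\<Sum>A\<in>UNIV. a j A * mw_kernel (Q j) A X))"
  proof (rule sum_subsets_eqD)
    fix J
    have "(\<Sum>X\<in>Pow J. \<Sum>j\<in>I. K j * (\<Sum>A\<in>UNIV. a j A * mw_kernel (Q j) A X))
        = (\<Sum>j\<in>I. K j * (\<Sum>X\<in>Pow J. \<Sum>A\<in>UNIV. a j A * mw_kernel (Q j) A X))"
      by (subst sum.swap) (simp add: sum_distrib_left)
    also have "\<dots> = (\<Sum>j\<in>I. K j * (\<Sum>A\<in>UNIV. a j A * (\<Sum>X\<in>Pow J. mw_kernel (Q j) A X)))"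
      unfolding sum_distrib_left[of "a _ _"] by (subst (2) sum.swap) (rule refl)
    also have "\<dots> = (\<Sum>j\<in>I. K j * (\<Sum>A\<in>UNIV. if A \<subseteq> - J then Q j ^ card J * a j A else 0))"
      unfolding mw_kernel_sum_subsets by (intro sum.cong arg_cong2[where f = "(*)"] refl) auto
    also have "\<dots> = (\<Sum>j\<in>I. K j * (\<Sum>A\<in>Pow (- J). Q j ^ card J * a j A))"
      by (simp add: Pow_def sum.inter_filter[symmetric])
    also have "\<dots> = (\<Sum>X\<in>Pow J. b X)"
      unfolding dual by (simp add: sum_distrib_left mult_ac)
    finally show "(\<Sum>X\<in>Pow J. b X)
      = (\<Sum>X\<in>Pow J. \<Sum>j\<in>I. K j * (\<Sum>A\<in>UNIV. a j A * mw_kernel (Q j) A X))" ..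
  qed
  have "harm_poly d f b x y
      = (\<Sum>j\<in>I. K j * (\<Sum>A\<in>UNIV. a j A * harm_poly d f (mw_kernel (Q j) A) x y))"
    unfolding b harm_poly_sum harm_poly_scale ..
  also have "\<dots> = (\<Sum>j\<in>I. K j * (- Q j) ^ d * harm_poly d f (a j) (x + (Q j - 1) * y) (x - y))"
    unfolding harm_poly_kernel[OF f xy] unfolding harm_poly_def
    by (simp add: sum_distrib_left mult_ac)
  finally show ?thesis .
qed

section \<open>Counting in subspaces over a finite field\<close>

lemma card_subspace:
  fixes S :: "('a::{field,finite} ^ 'n::finite) set"
  assumes "vec.subspace S"
  shows "card S = CARD('a) ^ vec.dim S"
proof -
  obtain B where B: "B \<subseteq> S" "vec.independent B" "S \<subseteq> vec.span B" "card B = vec.dim S"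
    using vec.basis_exists[of S] by metis
  have "S = vec.span B" using B assms by (simp add: vec.span_subspace)
  moreover have "finite B" by simp
  then have "card (vec.span B) = CARD('a) ^ card B" using B(2)
  proof (induction B rule: finite_induct)
    case empty
    then show ?case by simp
  next
    case (insert b B)
    have ind: "vec.independent B" and b: "b \<notin> vec.span B"
      using insert.prems insert.hyps by (auto simp: vec.independent_insert)
    let ?h = "\<lambda>(k, v). k *s b + v"
    have "vec.span (insert b B) = ?h ` (UNIV \<times> vec.span B)"
    proof (intro equalityI subsetI)
      fix x assume "x \<in> vec.span (insert b B)"
      then obtain k where "x - k *s b \<in> vec.span B" by (auto simp: vec.span_breakdown_eq)
      moreover have "x = ?h (k, x - k *s b)" by simp
      ultimately show "x \<in> ?h ` (UNIV \<times> vec.span B)" by blast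
    next
      fix x assume "x \<in> ?h ` (UNIV \<times> vec.span B)"
      then obtain k v where "x = k *s b + v" "v \<in> vec.span B" by auto
      then have "x - k *s b \<in> vec.span B" by simp
      then show "x \<in> vec.span (insert b B)" unfolding vec.span_breakdown_eq by blast
    qed
    moreover have "inj_on ?h (UNIV \<times> vec.span B)"
    proof (rule inj_onI)
      fix p p' assume "p \<in> UNIV \<times> vec.span B" "p' \<in> UNIV \<times> vec.span B" "?h p = ?h p'"
      then obtain k v k' v' where p: "p = (k, v)" "p' = (k', v')"
        and v: "v \<in> vec.span B" "v' \<in> vec.span B" and eq: "k *s b + v = k' *s b + v'" by auto
      have "k *s b = k' *s b + v' - v" using eq by (metis add_diff_cancel_right')
      then have d: "(k - k') *s b = v' - v" unfolding vec.scale_left_diff_distrib by simp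
      have "k = k'"
      proof (rule ccontr)
        assume "k \<noteq> k'"
        then have "b = (inverse (k - k') * (k - k')) *s b" by simp
        also have "\<dots> = inverse (k - k') *s ((k - k') *s b)" by (simp only: vec.scale_scale)
        also have "\<dots> \<in> vec.span B" unfolding d by (intro vec.span_scale vec.span_diff v)
        finally show False using b by simp
      qed
      then show "p = p'" using eq p by simp
    qed
    ultimately have "card (vec.span (insert b B)) = CARD('a) * card (vec.span B)"
      by (simp add: card_image card_cartesian_product)
    then show ?case using insert.IH[OF ind] insert.hyps by simp
  qed
  ultimately show ?thesis using B(4) by simp
qed

definition indep_lists :: "nat \<Rightarrow> ('a::{field,finite} ^ 'n::finite) set \<Rightarrow> ('a ^ 'n) list set" where
  "indep_lists r S = {xs. length xs = r \<and> distinct xs \<and> vec.independent (set xs) \<and> set xs \<subseteq> S}"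

lemma finite_indep_lists: "finite (indep_lists r S)"
proof -
  have "finite {xs. set xs \<subseteq> S \<and> length xs = r}" by (rule finite_lists_length_eq) simp
  then show ?thesis by (rule rev_finite_subset) (auto simp: indep_lists_def)
qed

text \<open>
  An independent list of length \<open>r\<close> spans \<open>q ^ r\<close> vectors, and any other vector of \<open>S\<close> extends it. If \<open>r\<close>
  exceeds the dimension, both sides are \<open>0\<close>, the product because \<open>card S\<close> is itself a power of \<open>q\<close>.
\<close>

lemma card_indep_lists:
  fixes S :: "('a::{field,finite} ^ 'n::finite) set"
  assumes S: "vec.subspace S"
  shows "real (card (indep_lists r S)) = (\<Prod>i<r. real (card S) - real CARD('a) ^ i)"
proof (induction r)
  case 0
  have "indep_lists 0 S = {[]}" by (auto simp: indep_lists_def vec.independent_empty)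
  then show ?case by simp
next
  case (Suc r)
  have eq: "indep_lists (Suc r) S
      = (\<lambda>(xs, a). a # xs) ` (SIGMA xs : indep_lists r S. S - vec.span (set xs))"
  proof (intro equalityI subsetI)
    fix ys assume "ys \<in> indep_lists (Suc r) S"
    then obtain a xs where ys: "ys = a # xs" and "xs \<in> indep_lists r S" "a \<in> S - vec.span (set xs)"
      by (cases ys) (auto simp: indep_lists_def vec.independent_insert)
    then show "ys \<in> (\<lambda>(xs, a). a # xs) ` (SIGMA xs : indep_lists r S. S - vec.span (set xs))"
      by force
  next
    fix ys assume "ys \<in> (\<lambda>(xs, a). a # xs) ` (SIGMA xs : indep_lists r S. S - vec.span (set xs))"
    then obtain xs a where ys: "ys = a # xs" and xs: "xs \<in> indep_lists r S"
      and a: "a \<in> S" "a \<notin> vec.span (set xs)" by auto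
    moreover have "vec.independent (insert a (set xs))"
      using xs a(2) by (intro vec.independent_insertI) (auto simp: indep_lists_def)
    ultimately show "ys \<in> indep_lists (Suc r) S"
      using vec.span_base[of a "set xs"] by (auto simp: indep_lists_def)
  qed
  have inj: "inj_on (\<lambda>(xs, a). a # xs) (SIGMA xs : indep_lists r S. S - vec.span (set xs))"
    by (auto simp: inj_on_def)
  have c: "real (card (S - vec.span (set xs))) = real (card S) - real CARD('a) ^ r"
    if "xs \<in> indep_lists r S" for xs
  proof -
    have xs: "vec.independent (set xs)" "card (set xs) = r" "set xs \<subseteq> S"
      using that by (auto simp: indep_lists_def distinct_card)
    have sub: "vec.span (set xs) \<subseteq> S" by (rule vec.span_minimal[OF xs(3) S])
    have "card (vec.span (set xs)) = CARD('a) ^ r"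
      using card_subspace[OF vec.subspace_span, of "set xs"] xs
      by (simp add: vec.dim_span_eq_card_independent del: vec.dim_span)
    then show ?thesis
      using sub card_mono[OF _ sub] by (simp add: card_Diff_subset of_nat_diff)
  qed
  have "real (card (indep_lists (Suc r) S)) = (\<Sum>xs\<in>indep_lists r S. real (card (S - vec.span (set xs))))"
    unfolding eq card_image[OF inj] by (subst card_SigmaI) (auto simp: finite_indep_lists)
  also have "\<dots> = real (card (indep_lists r S)) * (real (card S) - real CARD('a) ^ r)"
    using c by simp
  finally show ?case using Suc.IH by simp
qed

text \<open>
  Each independent list of length \<open>r\<close> spans exactly one \<open>r\<close>-dimensional subspace, and each such
  subspace is spanned by \<open>q_bracket q r\<close> of them.
\<close>

lemma card_subcodes:
  fixes S :: "('a::{field,finite} ^ 'n::finite) set"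
  assumes S: "vec.subspace S"
  shows "real (card (subcodes r S)) * q_bracket CARD('a) r = (\<Prod>i<r. real (card S) - real CARD('a) ^ i)"
proof -
  have fib: "{xs \<in> indep_lists r S. vec.span (set xs) = D} = indep_lists r D" if "D \<in> subcodes r S" for D
  proof -
    have D: "vec.subspace D" "D \<subseteq> S" "vec.dim D = r" using that by (auto simp: subcodes_def)
    have "vec.span (set xs) = D" if "xs \<in> indep_lists r D" for xs
    proof -
      have xs: "vec.independent (set xs)" "card (set xs) = r" "set xs \<subseteq> D"
        using that by (auto simp: indep_lists_def distinct_card)
      then have "D \<subseteq> vec.span (set xs)" using D(3) by (intro vec.card_ge_dim_independent) auto
      then show ?thesis using vec.span_minimal[OF xs(3) D(1)] by auto
    qed
    then show ?thesis using D by (auto simp: indep_lists_def intro: vec.span_base)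
  qed
  have span_mem: "vec.span (set xs) \<in> subcodes r S" if "xs \<in> indep_lists r S" for xs
    using that S vec.span_minimal[of "set xs" S]
    by (auto simp: indep_lists_def subcodes_def distinct_card vec.dim_eq_card_independent)
  have "(\<Prod>i<r. real (card S) - real CARD('a) ^ i) = real (card (indep_lists r S))"
    using card_indep_lists[OF S] by simp
  also have "\<dots> = (\<Sum>xs\<in>indep_lists r S. 1)" by simp
  also have "\<dots> = (\<Sum>D\<in>subcodes r S. \<Sum>xs | xs \<in> indep_lists r S \<and> vec.span (set xs) = D. 1)"
    by (rule sum.group[symmetric]) (use span_mem finite_indep_lists in auto)
  also have "\<dots> = (\<Sum>D\<in>subcodes r S. q_bracket CARD('a) r)"
  proof (rule sum.cong[OF refl])
    fix D assume D: "D \<in> subcodes r S"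
    then have "vec.subspace D" "card D = CARD('a) ^ r"
      by (auto simp: subcodes_def card_subspace)
    then show "(\<Sum>xs | xs \<in> indep_lists r S \<and> vec.span (set xs) = D. 1) = q_bracket CARD('a) r"
      using card_indep_lists[of D r] by (simp add: fib[OF D] q_bracket_def)
  qed
  finally show ?thesis by simp
qed

section \<open>Duality of shortened codes\<close>

definition shortened :: "('a::{field,finite} ^ 'n::finite) set \<Rightarrow> 'n set \<Rightarrow> ('a ^ 'n) set" where
  "shortened C J = {u \<in> C. supp u \<subseteq> J}"

lemma supp_subset_iff: "supp u \<subseteq> J \<longleftrightarrow> (\<forall>i. i \<notin> J \<longrightarrow> u $ i = 0)"
  by (auto simp: supp_def)

lemma subspace_shortened: "vec.subspace C \<Longrightarrow> vec.subspace (shortened C J)"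
  by (auto simp: vec.subspace_def shortened_def supp_subset_iff)

lemma subcodes_shortened: "subcodes r (shortened C J) = {D \<in> subcodes r C. Supp D \<subseteq> J}"
  by (auto simp: subcodes_def shortened_def Supp_def)

lemma subspace_dual_code: "vec.subspace (dual_code C)"
  by (auto simp: vec.subspace_def dual_code_def distrib_right sum.distrib mult.assoc
      simp flip: sum_distrib_left)

definition dot :: "'a::field ^ 'n::finite \<Rightarrow> 'a ^ 'n \<Rightarrow> 'a" where
  "dot u v = (\<Sum>i\<in>UNIV. u $ i * v $ i)"

lemma dot_commute: "dot u v = dot v u"
  by (simp add: dot_def mult.commute)

lemma dot_add_left: "dot (u + w) v = dot u v + dot w v"
  by (simp add: dot_def distrib_right sum.distrib)

lemma dot_diff_left: "dot (u - w) v = dot u v - dot w v"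
  by (simp add: dot_def left_diff_distrib sum_subtractf)

lemma dot_scale_left: "dot (c *s u) v = c * dot u v"
  by (simp add: dot_def sum_distrib_left mult.assoc)

lemma card_orthogonal_hyperplane:
  fixes U :: "('a::{field,finite} ^ 'n::finite) set"
  assumes U: "vec.subspace U" and w: "w \<in> U" "dot w v \<noteq> 0"
  shows "CARD('a) * card {u \<in> U. dot u v = 0} = card U"
proof -
  define e where "e = inverse (dot w v) *s w"
  have e: "e \<in> U" "dot e v = 1" 
    using w U by (auto simp: e_def dot_scale_left vec.subspace_scale)
  let ?h = "\<lambda>(c, u). c *s e + u"
  have U_eq: "U = ?h ` (UNIV \<times> {u \<in> U. dot u v = 0})"
  proof (intro equalityI subsetI)
    fix u assume u: "u \<in> U"
    then have "u - dot u v *s e \<in> {u \<in> U. dot u v = 0}"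
      using e U by (simp add: dot_diff_left dot_scale_left vec.subspace_diff vec.subspace_scale)
    moreover have "u = ?h (dot u v, u - dot u v *s e)" by simp
    ultimately show "u \<in> ?h ` (UNIV \<times> {u \<in> U. dot u v = 0})" by blast
  qed (use e U in \<open>auto intro!: vec.subspace_add vec.subspace_scale\<close>)
  have inj: "inj_on ?h (UNIV \<times> {u \<in> U. dot u v = 0})"
  proof (rule inj_onI)
    fix p p' assume p: "p \<in> UNIV \<times> {u \<in> U. dot u v = 0}" "p' \<in> UNIV \<times> {u \<in> U. dot u v = 0}"
      and eq: "?h p = ?h p'"
    have "dot (?h p) v = fst p" "dot (?h p') v = fst p'"
      using p e by (auto simp: dot_add_left dot_scale_left)
    then show "p = p'" using eq by (cases p; cases p') auto
  qed
  have "card (?h ` (UNIV \<times> {u \<in> U. dot u v = 0})) = CARD('a) * card {u \<in> U. dot u v = 0}"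
    unfolding card_image[OF inj] by (rule card_cartesian_product)
  then show ?thesis unfolding U_eq[symmetric] ..
qed

lemma CARD_field_ge_2: "2 \<le> CARD('a::{field,finite})"
proof -
  have "card {0, 1 :: 'a} \<le> CARD('a)" by (rule card_mono) auto
  then show ?thesis by simp
qed

text \<open>
  Count the orthogonal pairs by the vector \<open>v\<close>: those orthogonal to all of \<open>U\<close> contribute \<open>card U\<close>, all others
  a hyperplane of \<open>U\<close>, which has \<open>card U / q\<close> elements.
\<close>

lemma card_dot_pairs:
  fixes U V :: "('a::{field,finite} ^ 'n::finite) set"
  assumes U: "vec.subspace U"
  shows "CARD('a) * card {(v, u). v \<in> V \<and> u \<in> U \<and> dot u v = 0}
    = (CARD('a) - 1) * card U * card {v \<in> V. \<forall>u\<in>U. dot u v = 0} + card V * card U"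
proof -
  let ?q = "CARD('a)" and ?R = "{v \<in> V. \<forall>u\<in>U. dot u v = 0}"
  have S: "{(v, u). v \<in> V \<and> u \<in> U \<and> dot u v = 0} = (SIGMA v : V. {u \<in> U. dot u v = 0})" by auto
  have "?q * card {(v, u). v \<in> V \<and> u \<in> U \<and> dot u v = 0} = (\<Sum>v\<in>V. ?q * card {u \<in> U. dot u v = 0})"
    unfolding S by (subst card_SigmaI) (auto simp: sum_distrib_left)
  also have "\<dots> = (\<Sum>v\<in>V. card U + (if v \<in> ?R then (?q - 1) * card U else 0))"
  proof (rule sum.cong[OF refl])
    fix v assume v: "v \<in> V"
    show "?q * card {u \<in> U. dot u v = 0} = card U + (if v \<in> ?R then (?q - 1) * card U else 0)"
    proof (cases "v \<in> ?R")
      case True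
      then have "{u \<in> U. dot u v = 0} = U" by auto
      moreover have "?q * card U = card U + (?q - 1) * card U"
        using CARD_field_ge_2[where 'a = 'a] by (cases ?q) auto
      ultimately show ?thesis using True by simp
    next
      case False
      then obtain w where "w \<in> U" "dot w v \<noteq> 0" using v by auto
      then show ?thesis using False card_orthogonal_hyperplane[OF U] by auto
    qed
  qed
  also have "\<dots> = card V * card U + (\<Sum>v\<in>V. if v \<in> ?R then (?q - 1) * card U else 0)"
    by (simp add: sum.distrib)
  also have "(\<Sum>v\<in>V. if v \<in> ?R then (?q - 1) * card U else 0) = (\<Sum>v\<in>V \<inter> ?R. (?q - 1) * card U)"
    by (rule sum.inter_restrict[symmetric]) simp
  also have "V \<inter> ?R = ?R" by auto
  finally show ?thesis by (simp add: mult_ac)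
qed

text \<open>
  Count the orthogonal pairs from either side; the terms \<open>card U * card V\<close> cancel.
\<close>

lemma card_radicals:
  fixes U V :: "('a::{field,finite} ^ 'n::finite) set"
  assumes U: "vec.subspace U" and V: "vec.subspace V"
  shows "card U * card {v \<in> V. \<forall>u\<in>U. dot u v = 0} = card V * card {u \<in> U. \<forall>v\<in>V. dot u v = 0}"
proof -
  have conv: "{(u, v). u \<in> U \<and> v \<in> V \<and> dot v u = 0} = {(v, u). v \<in> V \<and> u \<in> U \<and> dot u v = 0}\<inverse>"
  proof (rule set_eqI, clarify)
    fix u v
    show "(u, v) \<in> {(u, v). u \<in> U \<and> v \<in> V \<and> dot v u = 0}
      \<longleftrightarrow> (u, v) \<in> {(v, u). v \<in> V \<and> u \<in> U \<and> dot u v = 0}\<inverse>"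
      using dot_commute[of u v] by auto
  qed
  have R: "{u \<in> U. \<forall>v\<in>V. dot v u = 0} = {u \<in> U. \<forall>v\<in>V. dot u v = 0}"
    by (auto simp: dot_commute)
  have "(CARD('a) - 1) * (card U * card {v \<in> V. \<forall>u\<in>U. dot u v = 0}) + card V * card U
     = (CARD('a) - 1) * (card V * card {u \<in> U. \<forall>v\<in>V. dot u v = 0}) + card V * card U"
    using card_dot_pairs[OF U, of V] card_dot_pairs[OF V, of U]
    unfolding conv card_inverse R mult.assoc by (simp only: mult.commute[of "card U" "card V"])
  then have "(CARD('a) - 1) * (card U * card {v \<in> V. \<forall>u\<in>U. dot u v = 0})
     = (CARD('a) - 1) * (card V * card {u \<in> U. \<forall>v\<in>V. dot u v = 0})"
    by (rule add_right_imp_eq)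
  moreover have "CARD('a) - 1 > 0" using CARD_field_ge_2[where 'a = 'a] by linarith
  ultimately show ?thesis by simp
qed

lemma card_supported: "card {v :: 'a::{field,finite} ^ 'n::finite. supp v \<subseteq> J} = CARD('a) ^ card J"
proof -
  have "bij_betw (\<lambda>v. restrict (vec_nth v) J) {v :: 'a ^ 'n. supp v \<subseteq> J} (PiE J (\<lambda>_. UNIV))"
  proof (rule bij_betwI[where g = "\<lambda>h. \<chi> i. if i \<in> J then h i else 0"])
    fix h :: "'n \<Rightarrow> 'a" assume "h \<in> PiE J (\<lambda>_. UNIV)"
    then show "restrict (vec_nth (\<chi> i. if i \<in> J then h i else 0)) J = h"
      by (auto simp: fun_eq_iff PiE_def extensional_def)
  qed (auto simp: supp_subset_iff vec_eq_iff)
  then show ?thesis by (simp add: bij_betw_same_card card_PiE)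
qed

text \<open>
  Inside the vectors supported on \<open>J\<close>, those orthogonal to \<open>C\<close> form the shortened dual code; inside \<open>C\<close>,
  those orthogonal to all vectors supported on \<open>J\<close> vanish on \<open>J\<close>.
\<close>

lemma card_shortened_dual:
  fixes C :: "('a::{field,finite} ^ 'n::finite) set"
  assumes C: "vec.subspace C"
  shows "card C * card (shortened (dual_code C) J) = CARD('a) ^ card J * card (shortened C (- J))"
proof -
  let ?V = "{v :: 'a ^ 'n. supp v \<subseteq> J}"
  have V: "vec.subspace ?V" by (auto simp: vec.subspace_def supp_subset_iff)
  have "shortened (dual_code C) J = {v \<in> ?V. \<forall>u\<in>C. dot u v = 0}"
    by (auto simp: shortened_def dual_code_def dot_def mult.commute)
  moreover have "shortened C (- J) = {u \<in> C. \<forall>v\<in>?V. dot u v = 0}"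
  proof (intro equalityI subsetI)
    fix u assume "u \<in> shortened C (- J)"
    then have u: "u \<in> C" "\<And>i. i \<in> J \<Longrightarrow> u $ i = 0" by (auto simp: shortened_def supp_subset_iff)
    have "dot u v = 0" if "v \<in> ?V" for v
      unfolding dot_def using u that by (intro sum.neutral) (auto simp: supp_subset_iff)
    then show "u \<in> {u \<in> C. \<forall>v\<in>?V. dot u v = 0}" using u by simp
  next
    fix u assume u: "u \<in> {u \<in> C. \<forall>v\<in>?V. dot u v = 0}"
    have "u $ i = 0" if "i \<in> J" for i
    proof -
      have "axis i 1 \<in> ?V" using that by (auto simp: supp_subset_iff axis_def)
      then have "dot u (axis i 1) = 0" using u by blast
      then show ?thesis by (simp add: dot_def axis_def if_distrib cong: if_cong)
    qed
    then show "u \<in> shortened C (- J)" using u by (auto simp: shortened_def supp_subset_iff)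
  qed
  ultimately show ?thesis using card_radicals[OF C V] by (simp add: card_supported)
qed

section \<open>Higher weight enumerators\<close>

definition supp_count :: "nat \<Rightarrow> ('a::{field,finite} ^ 'n::finite) set \<Rightarrow> 'n set \<Rightarrow> real" where
  "supp_count r C X = real (card {D \<in> subcodes r C. Supp D = X})"

lemma sum_supp_count:
  "(\<Sum>X\<in>S. supp_count r C X * g X) = (\<Sum>D | D \<in> subcodes r C \<and> Supp D \<in> S. g (Supp D))"
proof -
  have "(\<Sum>D | D \<in> subcodes r C \<and> Supp D \<in> S. g (Supp D))
      = (\<Sum>X\<in>S. \<Sum>D | D \<in> {D. D \<in> subcodes r C \<and> Supp D \<in> S} \<and> Supp D = X. g (Supp D))"
    by (rule sum.group[symmetric]) auto
  also have "\<dots> = (\<Sum>X\<in>S. \<Sum>D | D \<in> subcodes r C \<and> Supp D = X. g X)"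
    by (intro sum.cong refl) auto
  finally show ?thesis by (simp add: supp_count_def)
qed

lemma sum_supp_count_subsets:
  fixes C :: "('a::{field,finite} ^ 'n::finite) set"
  assumes "vec.subspace C"
  shows "(\<Sum>X\<in>Pow J. supp_count r C X) * q_bracket CARD('a) r
       = (\<Prod>i<r. real (card (shortened C J)) - real CARD('a) ^ i)"
proof -
  have "(\<Sum>X\<in>Pow J. supp_count r C X) = real (card (subcodes r (shortened C J)))"
    using sum_supp_count[of r C "\<lambda>_. 1" "Pow J"] by (simp add: subcodes_shortened)
  then show ?thesis using card_subcodes[OF subspace_shortened[OF assms]] by simp
qed

text \<open>
  The number of \<open>j\<close>-tuples of codewords whose supports have union \<open>X\<close>: a given \<open>l\<close>-dimensional
  subspace is spanned by \<open>qbinom q j l * q_bracket q l\<close> of the \<open>j\<close>-tuples of its vectors.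
\<close>

definition tuple_count :: "nat \<Rightarrow> ('a::{field,finite} ^ 'n::finite) set \<Rightarrow> 'n set \<Rightarrow> real" where
  "tuple_count j C X =
     (\<Sum>l\<le>j. qbinom (real CARD('a)) j l * q_bracket CARD('a) l * supp_count l C X)"

lemma sum_tuple_count_subsets:
  fixes C :: "('a::{field,finite} ^ 'n::finite) set"
  assumes C: "vec.subspace C"
  shows "(\<Sum>X\<in>Pow J. tuple_count j C X) = real (card (shortened C J)) ^ j"
proof -
  let ?q = "real CARD('a)"
  have "(\<Sum>X\<in>Pow J. tuple_count j C X)
      = (\<Sum>l\<le>j. qbinom ?q j l * ((\<Sum>X\<in>Pow J. supp_count l C X) * q_bracket CARD('a) l))"
    unfolding tuple_count_def by (subst sum.swap) (simp add: sum_distrib_left sum_distrib_right mult_ac)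
  also have "\<dots> = real (card (shortened C J)) ^ j"
    unfolding sum_supp_count_subsets[OF C] by (rule power_eq_qbinom_sum[symmetric])
  finally show ?thesis .
qed

text \<open>
  Subcodes of the dual code on the left, tuples of codewords of \<open>C\<close> on the right. The subcode count of the dual
  code expands in powers of the number of its words supported in \<open>J\<close>, and duality makes the \<open>j\<close>-th power a
  multiple of \<open>(q ^ j) ^ card J\<close> times a tuple count of \<open>C\<close> on \<open>- J\<close>.
\<close>

lemma harm_poly_dual_code:
  fixes C :: "('a::{field,finite} ^ 'n::finite) set"
  assumes C: "vec.subspace C" and f: "f \<in> Harm d" and xy: "x \<noteq> 0" "y \<noteq> 0"
  defines "q \<equiv> real CARD('a)"
  shows "harm_poly d f (supp_count r (dual_code C)) x y =
    (\<Sum>j\<le>r. (-1) ^ (r - j) * q ^ ((r - j) choose 2) * qbinom q r j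
        / (q_bracket CARD('a) r * q ^ (vec.dim C * j)) * (- (q ^ j)) ^ d
       * harm_poly d f (tuple_count j C) (x + (q ^ j - 1) * y) (x - y))"
proof (rule harm_macwilliams[OF f xy])
  fix J :: "'n set"
  let ?z = "real (card (shortened (dual_code C) J))" and ?w = "real (card (shortened C (- J)))"
  have q: "q > 0" and br: "q_bracket CARD('a) r > 0"
    unfolding q_def by (simp, intro q_bracket_pos CARD_field_ge_2)
  have "q ^ vec.dim C * ?z = q ^ card J * ?w"
    using arg_cong[OF card_shortened_dual[OF C, of J], of real]
    by (simp add: card_subspace[OF C] q_def)
  then have z: "?z = q ^ card J * ?w / q ^ vec.dim C"
    using q by (simp add: field_simps)
  have "(\<Sum>X\<in>Pow J. supp_count r (dual_code C) X)
      = (\<Prod>i<r. ?z - q ^ i) / q_bracket CARD('a) r"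
    using sum_supp_count_subsets[where C = "dual_code C" and J = J and r = r, OF subspace_dual_code] br by (simp add: q_def field_simps)
  also have "\<dots> = (\<Sum>j\<le>r. (-1) ^ (r - j) * q ^ ((r - j) choose 2) * qbinom q r j * ?z ^ j
      / q_bracket CARD('a) r)"
    unfolding q_binomial_theorem by (rule sum_divide_distrib)
  also have "\<dots> = (\<Sum>j\<le>r. (-1) ^ (r - j) * q ^ ((r - j) choose 2) * qbinom q r j
        / (q_bracket CARD('a) r * q ^ (vec.dim C * j)) * (q ^ j) ^ card J
       * (\<Sum>X\<in>Pow (- J). tuple_count j C X))"
    unfolding sum_tuple_count_subsets[OF C] z power_divide power_mult_distrib power_mult[symmetric]
    by (rule sum.cong[OF refl]) (simp add: mult_ac)
  finally show "(\<Sum>X\<in>Pow J. supp_count r (dual_code C) X) = \<dots>" .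
qed

lemma harm_poly_supp_count:
  fixes C :: "('a::{field,finite} ^ 'n::finite) set"
  assumes f: "f \<in> Harm d"
  shows "harm_poly d f (supp_count r C) u v
    = (\<Sum>i = d..CARD('n) - d. A_harm r d f C i * u ^ (CARD('n) - i - d) * v ^ (i - d))"
proof -
  let ?n = "CARD('n)"
  let ?g = "\<lambda>X. harm_ext d f X * (u ^ (?n - card X - d) * v ^ (card X - d))"
  have "harm_poly d f (supp_count r C) u v = (\<Sum>X\<in>UNIV. supp_count r C X * ?g X)"
    unfolding harm_poly_def by (simp add: mult_ac)
  also have "\<dots> = (\<Sum>D\<in>subcodes r C. ?g (Supp D))"
    unfolding sum_supp_count by simp
  also have "\<dots> = (\<Sum>D | D \<in> subcodes r C \<and> wt D \<in> {d..?n - d}. ?g (Supp D))"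
  proof (rule sum.mono_neutral_right)
    show "\<forall>D\<in>subcodes r C - {D. D \<in> subcodes r C \<and> wt D \<in> {d..?n - d}}. ?g (Supp D) = 0"
      using harm_ext_outside[OF f] by (auto simp: wt_def not_le)
  qed auto
  also have "\<dots> = (\<Sum>i = d..?n - d. \<Sum>D | D \<in> {D. D \<in> subcodes r C \<and> wt D \<in> {d..?n - d}} \<and> wt D = i.
      ?g (Supp D))"
    by (rule sum.group[symmetric]) auto
  also have "\<dots> = (\<Sum>i = d..?n - d. A_harm r d f C i * u ^ (?n - i - d) * v ^ (i - d))"
  proof (rule sum.cong[OF refl])
    fix i assume i: "i \<in> {d..?n - d}"
    then have "{D. D \<in> {D. D \<in> subcodes r C \<and> wt D \<in> {d..?n - d}} \<and> wt D = i}
        = {D. D \<in> subcodes r C \<and> wt D = i}" by auto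
    moreover have "(\<Sum>D | D \<in> subcodes r C \<and> wt D = i. ?g (Supp D))
        = (\<Sum>D | D \<in> subcodes r C \<and> wt D = i. harm_ext d f (Supp D) * (u ^ (?n - i - d) * v ^ (i - d)))"
      by (rule sum.cong[OF refl]) (simp add: wt_def)
    ultimately show "(\<Sum>D | D \<in> {D. D \<in> subcodes r C \<and> wt D \<in> {d..?n - d}} \<and> wt D = i. ?g (Supp D))
        = A_harm r d f C i * u ^ (?n - i - d) * v ^ (i - d)"
      unfolding A_harm_def by (simp add: sum_distrib_right mult.assoc)
  qed
  finally show ?thesis .
qed

definition eval2 :: "real poly poly \<Rightarrow> real \<Rightarrow> real \<Rightarrow> real" where
  "eval2 p x y = poly (poly p [:y:]) x"

lemma eval2_Z_harm:
  fixes C :: "('a::{field,finite} ^ 'n::finite) set"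
  assumes "f \<in> Harm d"
  shows "eval2 (Z_harm r d f C u v) x y = harm_poly d f (supp_count r C) (eval2 u x y) (eval2 v x y)"
  unfolding harm_poly_supp_count[OF assms] Z_harm_def eval2_def by (simp add: poly_sum mult_ac)

lemma poly_eqI_infinite:
  fixes p p' :: "'b::{idom,ring_char_0} poly"
  assumes "infinite S" and "\<And>x. x \<in> S \<Longrightarrow> poly p x = poly p' x"
  shows "p = p'"
proof (rule ccontr)
  assume "p \<noteq> p'"
  then have "finite {x. poly (p - p') x = 0}" by (intro poly_roots_finite) simp
  moreover have "S \<subseteq> {x. poly (p - p') x = 0}" using assms(2) by auto
  ultimately show False using assms(1) finite_subset by blast
qed

text \<open>
  Apply the univariate statement twice: at the infinitely many constants \<open>[:y:]\<close>, and then to the resulting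
  polynomials in \<open>x\<close>.
\<close>

lemma eval2_eqI:
  assumes "\<And>x y. x \<noteq> 0 \<Longrightarrow> y \<noteq> 0 \<Longrightarrow> eval2 p x y = eval2 p' x y"
  shows "p = p'"
proof -
  have inf: "infinite (- {0 :: real})" by (simp add: Compl_eq_Diff_UNIV infinite_UNIV_char_0)
  show ?thesis
  proof (rule poly_eqI_infinite)
    show "infinite ((\<lambda>y :: real. [:y:]) ` (- {0}))"
      using inf by (subst finite_image_iff) (auto simp: inj_on_def)
    fix c assume "c \<in> (\<lambda>y :: real. [:y:]) ` (- {0})"
    then obtain y where y: "c = [:y:]" "y \<noteq> 0" by auto
    show "poly p c = poly p' c"
      using assms y by (intro poly_eqI_infinite[OF inf]) (auto simp: eval2_def)
  qed
qed

text \<open>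
  The product of the two transition coefficients and the MacWilliams factor. By the quotient formula the
  brackets of \<open>r\<close>, \<open>j\<close> and \<open>l\<close> cancel, and the powers of \<open>q\<close> combine to the stated integer exponent.
\<close>

lemma coefficient_eq:
  fixes q :: nat
  assumes q: "2 \<le> q" and j: "j \<le> r" and l: "l \<le> j"
  shows "(-1) ^ (r - j) * real q ^ ((r - j) choose 2) * qbinom (real q) r j
        / (q_bracket q r * real q ^ (k * j)) * (- (real q ^ j)) ^ d
        * (qbinom (real q) j l * q_bracket q l)
     = (-1) ^ (r + d - j) *
         (real q powi (int ((r - j) choose 2) - int j * int (r - j) - int l * int (j - l)
                        - int j * (int k - int d))
          / (q_bracket q (r - j) * q_bracket q (j - l)))"
proof -
  let ?q = "real q"
  have q0: "?q > 0" using q by simp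
  have br: "q_bracket q a \<noteq> 0" for a using q_bracket_pos[OF q, of a] by simp
  have "qbinom ?q r j * (q_bracket q j * q_bracket q (r - j) * ?q ^ (j * (r - j))) = q_bracket q r"
    using qbinom_q_bracket[of q j "r - j"] j by (simp add: mult_ac)
  then have g1: "qbinom ?q r j = q_bracket q r / (q_bracket q j * q_bracket q (r - j) * ?q ^ (j * (r - j)))"
    using q0 br by (simp add: eq_divide_eq)
  have "qbinom ?q j l * q_bracket q l * (q_bracket q (j - l) * ?q ^ (l * (j - l))) = q_bracket q j"
    using qbinom_q_bracket[of q l "j - l"] l by (simp add: mult_ac)
  then have g2: "qbinom ?q j l * q_bracket q l = q_bracket q j / (q_bracket q (j - l) * ?q ^ (l * (j - l)))"
    using q0 br by (simp add: eq_divide_eq)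
  have e: "int ((r - j) choose 2) - int j * int (r - j) - int l * int (j - l) - int j * (int k - int d)
      = int (((r - j) choose 2) + j * d) - int (j * (r - j) + l * (j - l) + k * j)"
    by (simp only: of_nat_add of_nat_mult right_diff_distrib) (simp add: mult_ac)
  have p: "?q powi (int ((r - j) choose 2) - int j * int (r - j) - int l * int (j - l) - int j * (int k - int d))
      = ?q ^ ((r - j) choose 2) * ?q ^ (j * d) / (?q ^ (j * (r - j)) * ?q ^ (l * (j - l)) * ?q ^ (k * j))"
    unfolding e using q0 by (simp add: power_int_diff power_int_of_nat power_add del: of_nat_add of_nat_mult of_nat_diff)
  have s: "(- (?q ^ j)) ^ d = (-1) ^ d * ?q ^ (j * d)"
    by (metis mult_minus1 power_mult_distrib power_mult)
  have sg: "(-1 :: real) ^ (r + d - j) = (-1) ^ (r - j) * (-1) ^ d"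
    using j by (simp flip: power_add)
  show ?thesis unfolding g1 g2 p s sg using q0 br by (simp add: mult_ac)
qed

theorem theorem3p1:
  fixes C :: "('a::{field,finite} ^ 'n::finite) set"
    and f :: "'n set \<Rightarrow> real"
    and q k d r :: nat
  assumes "CARD('a) = q"
    and "vec.subspace C" and "vec.dim C = k"
    and "1 \<le> d" and "d \<le> CARD('n)"
    and "f \<in> Harm d"
  shows "Z_harm r d f (dual_code C) var_x var_y =
    (\<Sum>j=0..r. \<Sum>l=0..j.
       const2 ((-1) ^ (r + d - j) *
         (real q powi (int ((r - j) choose 2) - int j * int (r - j) - int l * int (j - l)
                        - int j * (int k - int d))
          / (q_bracket q (r - j) * q_bracket q (j - l))))
       * Z_harm l d f C (var_x + const2 (real q ^ j - 1) * var_y) (var_x - var_y))"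
    (is "?L = (\<Sum>j=0..r. \<Sum>l=0..j. const2 (?c j l) * ?Z j l)")
proof (rule eval2_eqI)
  fix x y :: real assume xy: "x \<noteq> 0" "y \<noteq> 0"
  note f = \<open>f \<in> Harm d\<close>
  have q: "2 \<le> q" using CARD_field_ge_2[where 'a = 'a] assms(1) by simp
  have vars: "eval2 var_x x y = x" "eval2 var_y x y = y" "eval2 (var_x - var_y) x y = x - y"
    "eval2 (var_x + const2 c * var_y) x y = x + c * y" for c
    by (simp_all add: eval2_def var_x_def var_y_def)
  let ?P = "\<lambda>j l. harm_poly d f (supp_count l C) (x + (real q ^ j - 1) * y) (x - y)"
  let ?K = "\<lambda>j. (-1) ^ (r - j) * real q ^ ((r - j) choose 2) * qbinom (real q) r j
        / (q_bracket q r * real q ^ (k * j)) * (- (real q ^ j)) ^ d"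
  have "eval2 ?L x y = harm_poly d f (supp_count r (dual_code C)) x y"
    by (simp add: eval2_Z_harm[OF f] vars)
  also have "\<dots> = (\<Sum>j\<le>r. ?K j * (\<Sum>l\<le>j. qbinom (real q) j l * q_bracket q l * ?P j l))"
    unfolding harm_poly_dual_code[OF assms(2) f xy] tuple_count_def[abs_def]
      harm_poly_sum harm_poly_scale assms(1,3) ..
  also have "\<dots> = (\<Sum>j\<le>r. \<Sum>l\<le>j. ?c j l * ?P j l)"
    unfolding sum_distrib_left mult.assoc[symmetric, of "?K _"]
    by (intro sum.cong refl, subst coefficient_eq[OF q, symmetric]) (simp_all add: mult.assoc)
  also have "\<dots> = eval2 (\<Sum>j=0..r. \<Sum>l=0..j. const2 (?c j l) * ?Z j l) x y"
  proof -
    have "eval2 (\<Sum>j=0..r. \<Sum>l=0..j. const2 (?c j l) * ?Z j l) x y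
        = (\<Sum>j=0..r. \<Sum>l=0..j. ?c j l * eval2 (?Z j l) x y)"
      by (simp add: eval2_def poly_sum)
    then show ?thesis by (simp only: eval2_Z_harm[OF f] vars atMost_atLeast0)
  qed
  finally show "eval2 ?L x y = eval2 (\<Sum>j=0..r. \<Sum>l=0..j. const2 (?c j l) * ?Z j l) x y" .
qed

end
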